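(* Let $(X,d)$ be a CAT(0) space. Then the metric $d:X\times X\to\mathbb{R}$ is convex, i.e. for any two geodesics $\gamma_1,\gamma_2:[0,1]\to X$ and all $t\in[0,1]$, $$d(\gamma_1(t),\gamma_2(t))\le(1-t)\,d(\gamma_1(0),\gamma_2(0))+t\,d(\gamma_1(1),\gamma_2(1)).$$
   Context: A geodesic in $(X,d)$ is a map $\gamma:[a,b]\to X$ for which there is $\lambda\ge0$ with $d(\gamma(t),\gamma(t'))=\lambda|t-t'|$ for all $t,t'$; $X$ is geodesic if any two points are joined by a geodesic. A geodesic triangle $\Delta(x,y,z)$ consists of three points and a choice of three geodesic segments joining them. A comparison triangle is a triangle $\overline\Delta(\overline x,\overline y,\overline z)$ in the Euclidean plane $\mathbb{E}^2$ with the same side lengths; the comparison point of $p\in[x,y]$ is the $\overline p\in[\overline x,\overline y]$ with $d(x,p)=d(\overline x,\overline p)$, and similarly for the other sides. A CAT(0) space is a geodesic metric space such that for every geodesic triangle $\Delta$ and all $p,q\in\Delta$ with comparison points $\overline p,\overline q$, $d(p,q)\le d(\overline p,\overline q)$. *)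

theory Defs
  imports "HOL-Analysis.Analysis"
begin

context Metric_space
begin

definition geodesic :: "real \<Rightarrow> real \<Rightarrow> (real \<Rightarrow> 'a) \<Rightarrow> bool" where
  "geodesic a b \<gamma> \<longleftrightarrow>
     a \<le> b \<and> \<gamma> \<in> {a..b} \<rightarrow> M \<and>
     (\<exists>c\<ge>0. \<forall>t\<in>{a..b}. \<forall>t'\<in>{a..b}. d (\<gamma> t) (\<gamma> t') = c * \<bar>t - t'\<bar>)"

definition geodesic_segment :: "'a \<Rightarrow> 'a \<Rightarrow> 'a set \<Rightarrow> bool" where
  "geodesic_segment x y S \<longleftrightarrow>
     (\<exists>a b \<gamma>. geodesic a b \<gamma> \<and> \<gamma> a = x \<and> \<gamma> b = y \<and> S = \<gamma> ` {a..b})"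

definition geodesic_space :: bool where
  "geodesic_space \<longleftrightarrow>
     (\<forall>x\<in>M. \<forall>y\<in>M. \<exists>a b \<gamma>. geodesic a b \<gamma> \<and> \<gamma> a = x \<and> \<gamma> b = y)"

text \<open>The triangle with vertices \<open>x\<close>, \<open>y\<close>, \<open>z\<close> and chosen sides \<open>A = [x,y]\<close>, \<open>B = [y,z]\<close>,
  \<open>C = [z,x]\<close>; as a subset of the space it is \<open>A \<union> B \<union> C\<close>.\<close>

definition geodesic_triangle ::
    "'a \<Rightarrow> 'a \<Rightarrow> 'a \<Rightarrow> 'a set \<Rightarrow> 'a set \<Rightarrow> 'a set \<Rightarrow> bool" where
  "geodesic_triangle x y z A B C \<longleftrightarrow>
     geodesic_segment x y A \<and> geodesic_segment y z B \<and> geodesic_segment z x C"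

definition comparison_triangle ::
    "'a \<Rightarrow> 'a \<Rightarrow> 'a \<Rightarrow> real^2 \<Rightarrow> real^2 \<Rightarrow> real^2 \<Rightarrow> bool" where
  "comparison_triangle x y z x' y' z' \<longleftrightarrow>
     dist x' y' = d x y \<and> dist y' z' = d y z \<and> dist z' x' = d z x"

definition side_comparison_point ::
    "'a \<Rightarrow> 'a set \<Rightarrow> real^2 \<Rightarrow> real^2 \<Rightarrow> 'a \<Rightarrow> real^2 \<Rightarrow> bool" where
  "side_comparison_point x S x' y' p p' \<longleftrightarrow>
     p \<in> S \<and> p' \<in> closed_segment x' y' \<and> d x p = dist x' p'"

text \<open>A relation rather than a function: a point lying on several sides has a comparison point
  for each of them.\<close>

definition comparison_point ::
    "'a \<Rightarrow> 'a \<Rightarrow> 'a \<Rightarrow> 'a set \<Rightarrow> 'a set \<Rightarrow> 'a set \<Rightarrow>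
     real^2 \<Rightarrow> real^2 \<Rightarrow> real^2 \<Rightarrow> 'a \<Rightarrow> real^2 \<Rightarrow> bool" where
  "comparison_point x y z A B C x' y' z' p p' \<longleftrightarrow>
     side_comparison_point x A x' y' p p' \<or>
     side_comparison_point y B y' z' p p' \<or>
     side_comparison_point z C z' x' p p'"

end

locale CAT0_space = Metric_space +
  assumes geodesic_space: "geodesic_space"
    and CAT0_inequality:
      "\<lbrakk>geodesic_triangle x y z A B C; comparison_triangle x y z x' y' z';
        p \<in> A \<union> B \<union> C; q \<in> A \<union> B \<union> C;
        comparison_point x y z A B C x' y' z' p p';
        comparison_point x y z A B C x' y' z' q q'\<rbrakk>
       \<Longrightarrow> d p q \<le> dist p' q'"

end

theory Submission
  imports Defs
begin

text \<open>
  A triangle in the Euclidean plane satisfies the intercept theorem: the points that divide two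
  sides issuing from a common vertex in the ratio \<open>t\<close> lie at distance exactly \<open>t\<close> times the length
  of the third side. The CAT(0) inequality transports this to the space as an upper bound, so that
  two geodesics \<open>\<alpha>\<close>, \<open>\<beta>\<close> with a common starting point satisfy
  \<open>d (\<alpha> t) (\<beta> t) \<le> t * d (\<alpha> 1) (\<beta> 1)\<close> (\<open>dist_geodesics_common_start\<close>), and, by reversing time, two
  geodesics with a common endpoint satisfy \<open>d (\<alpha> t) (\<beta> t) \<le> (1 - t) * d (\<alpha> 0) (\<beta> 0)\<close>.

  For arbitrary geodesics \<open>\<gamma>\<^sub>1\<close>, \<open>\<gamma>\<^sub>2\<close>, cut the quadrilateral that they span by a diagonal, that is, a
  geodesic \<open>\<delta>\<close> from \<open>\<gamma>\<^sub>1 0\<close> to \<open>\<gamma>\<^sub>2 1\<close>. It shares its start with \<open>\<gamma>\<^sub>1\<close> and its end with \<open>\<gamma>\<^sub>2\<close>, and the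
  triangle inequality through \<open>\<delta> t\<close> adds the two bounds.

  Applying the CAT(0) inequality requires a Euclidean triangle with the given side lengths; it is
  constructed in coordinates (\<open>euclidean_triangle_exists\<close>).
\<close>

text \<open>Put the first two vertices on the horizontal axis. If \<open>a > 0\<close>, the law of cosines dictates the
  horizontal coordinate \<open>u\<close> of the third one, and the triangle inequalities say precisely that
  \<open>u\<^sup>2 \<le> c\<^sup>2\<close>, so that a real height remains.\<close>

lemma euclidean_triangle_exists:
  fixes a b c :: real
  assumes "0 \<le> a" "0 \<le> b" "0 \<le> c" "a \<le> b + c" "b \<le> a + c" "c \<le> a + b"
  shows "\<exists>x y z :: real^2. dist x y = a \<and> dist y z = b \<and> dist z x = c"
proof (cases "a = 0")
  case True
  then have "b = c" using assms by linarith
  obtain z :: "real^2" where "norm z = c"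
    using vector_choose_size[OF \<open>0 \<le> c\<close>] by blast
  then have "dist 0 (0::real^2) = a" "dist 0 z = b" "dist z 0 = c"
    using True \<open>b = c\<close> by simp_all
  then show ?thesis by blast
next
  case False
  with assms have a: "a > 0" by simp
  define u where "u = (a\<^sup>2 + c\<^sup>2 - b\<^sup>2) / (2 * a)"
  have au: "2 * a * u = a\<^sup>2 + c\<^sup>2 - b\<^sup>2" using a by (simp add: u_def)
  have "b\<^sup>2 \<le> (a + c)\<^sup>2" using assms by (intro power_mono) auto
  moreover have "(a - c)\<^sup>2 \<le> b\<^sup>2"
    using assms by (intro abs_le_square_iff[THEN iffD1]) auto
  ultimately have "2 * a * u \<le> 2 * a * c" "2 * a * (- c) \<le> 2 * a * u"
    using au by (auto simp: power2_eq_square algebra_simps)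
  moreover have "0 < 2 * a" using a by simp
  ultimately have "u \<le> c" "- c \<le> u" using mult_le_cancel_left_pos by blast+
  then have "\<bar>u\<bar> \<le> \<bar>c\<bar>" by simp
  then have "u\<^sup>2 \<le> c\<^sup>2" by (simp only: abs_le_square_iff)
  define x y z :: "real^2" where "x = 0" and "y = vector [a, 0]"
    and "z = vector [u, sqrt (c\<^sup>2 - u\<^sup>2)]"
  have "dist x y = a" "dist z x = c"
    using assms \<open>u\<^sup>2 \<le> c\<^sup>2\<close>
    by (simp_all add: dist_norm norm_vec_def L2_set_def sum_2 x_def y_def z_def)
  moreover have "(a - u)\<^sup>2 + (c\<^sup>2 - u\<^sup>2) = b\<^sup>2"
    using au by (simp add: power2_eq_square algebra_simps)
  then have "dist y z = b"
    using assms \<open>u\<^sup>2 \<le> c\<^sup>2\<close>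
    by (simp add: dist_norm norm_vec_def L2_set_def sum_2 y_def z_def)
  ultimately show ?thesis by blast
qed

context Metric_space
begin

lemma comparison_triangle_exists:
  assumes "x \<in> M" "y \<in> M" "z \<in> M"
  shows "\<exists>x' y' z'. comparison_triangle x y z x' y' z'"
  unfolding comparison_triangle_def
  using euclidean_triangle_exists[of "d x y" "d y z" "d z x"]
    triangle[of x z y] triangle[of y x z] triangle[of x y z] assms
  by (simp add: commute)

lemma geodesic_in_space:
  assumes "geodesic a b \<gamma>" "t \<in> {a..b}"
  shows "\<gamma> t \<in> M"
  using assms by (auto simp: geodesic_def)

lemma geodesic_unit_dist:
  assumes "geodesic 0 1 \<gamma>" "s \<in> {0..1}" "t \<in> {0..1}"
  shows "d (\<gamma> s) (\<gamma> t) = \<bar>s - t\<bar> * d (\<gamma> 0) (\<gamma> 1)"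
proof -
  obtain c where "\<forall>s\<in>{0..1}. \<forall>t\<in>{0..1}. d (\<gamma> s) (\<gamma> t) = c * \<bar>s - t\<bar>"
    using assms(1) by (auto simp: geodesic_def)
  then show ?thesis using assms(2,3) by simp
qed

lemma geodesic_affine_reparam:
  assumes \<gamma>: "geodesic a b \<gamma>" and "r \<le> s"
    and range: "\<And>t. t \<in> {r..s} \<Longrightarrow> k * t + l \<in> {a..b}"
  shows "geodesic r s (\<lambda>t. \<gamma> (k * t + l))"
proof -
  obtain c where "c \<ge> 0"
    and c: "\<forall>t\<in>{a..b}. \<forall>t'\<in>{a..b}. d (\<gamma> t) (\<gamma> t') = c * \<bar>t - t'\<bar>"
    using \<gamma> by (auto simp: geodesic_def)
  have "d (\<gamma> (k * t + l)) (\<gamma> (k * t' + l)) = (c * \<bar>k\<bar>) * \<bar>t - t'\<bar>"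
    if "t \<in> {r..s}" "t' \<in> {r..s}" for t t'
  proof -
    have "d (\<gamma> (k * t + l)) (\<gamma> (k * t' + l)) = c * \<bar>k * (t - t')\<bar>"
      using c range[OF that(1)] range[OF that(2)] by (simp add: right_diff_distrib)
    then show ?thesis by (simp add: abs_mult)
  qed
  moreover have "c * \<bar>k\<bar> \<ge> 0" using \<open>c \<ge> 0\<close> by simp
  moreover have "(\<lambda>t. \<gamma> (k * t + l)) \<in> {r..s} \<rightarrow> M"
    using geodesic_in_space[OF \<gamma> range] by auto
  ultimately show ?thesis using \<open>r \<le> s\<close> unfolding geodesic_def by blast
qed

lemma geodesic_reverse:
  assumes "geodesic 0 1 \<gamma>"
  shows "geodesic 0 1 (\<lambda>t. \<gamma> (1 - t))"
  using geodesic_affine_reparam[OF assms, of 0 1 "-1" 1] by simp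

lemma geodesic_unit_param_exists:
  assumes geodesic_space "x \<in> M" "y \<in> M"
  obtains \<gamma> where "geodesic 0 1 \<gamma>" "\<gamma> 0 = x" "\<gamma> 1 = y"
proof -
  obtain a b \<gamma> where \<gamma>: "geodesic a b \<gamma>" "\<gamma> a = x" "\<gamma> b = y"
    using assms unfolding geodesic_space_def by blast
  then have "a \<le> b" by (simp add: geodesic_def)
  have "(b - a) * t + a \<in> {a..b}" if "t \<in> {0..1}" for t
  proof -
    have "(b - a) * t \<le> (b - a) * 1"
      using that \<open>a \<le> b\<close> by (intro mult_left_mono) auto
    then show ?thesis using that \<open>a \<le> b\<close> by simp
  qed
  then have "geodesic 0 1 (\<lambda>t. \<gamma> ((b - a) * t + a))"
    by (intro geodesic_affine_reparam[OF \<gamma>(1)]) auto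
  then show ?thesis using that \<gamma>(2,3) by simp
qed

lemma geodesic_segment_unit:
  assumes "geodesic 0 1 \<gamma>"
  shows "geodesic_segment (\<gamma> 0) (\<gamma> 1) (\<gamma> ` {0..1})"
  using assms unfolding geodesic_segment_def by blast

text \<open>Affine parametrizations match comparison points: both \<open>\<gamma>\<close> and its model side have constant
  speed, so equal parameters lie at equal distances from the start.\<close>

lemma side_comparison_point_geodesic:
  assumes \<gamma>: "geodesic 0 1 \<gamma>" and t: "t \<in> {0..1}"
    and len: "dist x' y' = d (\<gamma> 0) (\<gamma> 1)"
  shows "side_comparison_point (\<gamma> 0) (\<gamma> ` {0..1}) x' y' (\<gamma> t) ((1 - t) *\<^sub>R x' + t *\<^sub>R y')"
proof -
  have "x' - ((1 - t) *\<^sub>R x' + t *\<^sub>R y') = t *\<^sub>R (x' - y')"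
    by (simp add: algebra_simps)
  then have "dist x' ((1 - t) *\<^sub>R x' + t *\<^sub>R y') = t * dist x' y'"
    using t by (simp add: dist_norm)
  moreover have "d (\<gamma> 0) (\<gamma> t) = t * d (\<gamma> 0) (\<gamma> 1)"
    using geodesic_unit_dist[OF \<gamma>, of 0 t] t by simp
  ultimately show ?thesis
    using t len by (auto simp: side_comparison_point_def in_segment)
qed

end

context CAT0_space
begin

text \<open>The intercept theorem becomes an inequality. The two geodesics are sides of a triangle whose
  comparison triangle has vertices \<open>x'\<close>, \<open>y'\<close>, \<open>z'\<close>, and the comparison points of \<open>\<alpha> t\<close> and \<open>\<beta> t\<close>
  differ by \<open>t *\<^sub>R (y' - z')\<close>.\<close>

lemma dist_geodesics_common_start:
  assumes \<alpha>: "geodesic 0 1 \<alpha>" and \<beta>: "geodesic 0 1 \<beta>"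
    and start: "\<alpha> 0 = \<beta> 0" and t: "t \<in> {0..1}"
  shows "d (\<alpha> t) (\<beta> t) \<le> t * d (\<alpha> 1) (\<beta> 1)"
proof -
  have M: "\<alpha> 0 \<in> M" "\<alpha> 1 \<in> M" "\<beta> 1 \<in> M"
    using geodesic_in_space \<alpha> \<beta> by auto
  obtain \<sigma> where \<sigma>: "geodesic 0 1 \<sigma>" "\<sigma> 0 = \<alpha> 1" "\<sigma> 1 = \<beta> 1"
    using geodesic_unit_param_exists[OF geodesic_space M(2,3)] .
  \<comment> \<open>The sides of a triangle are oriented cyclically, so \<open>\<beta>\<close> is traversed towards the common
    vertex.\<close>
  define \<rho> where "\<rho> = (\<lambda>t. \<beta> (1 - t))"
  have \<rho>: "geodesic 0 1 \<rho>" "\<rho> 0 = \<beta> 1" "\<rho> 1 = \<alpha> 0" "\<rho> (1 - t) = \<beta> t"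
    using geodesic_reverse[OF \<beta>] start by (simp_all add: \<rho>_def)
  let ?A = "\<alpha> ` {0..1}" and ?B = "\<sigma> ` {0..1}" and ?C = "\<rho> ` {0..1}"
  have tri: "geodesic_triangle (\<alpha> 0) (\<alpha> 1) (\<beta> 1) ?A ?B ?C"
    using geodesic_segment_unit[OF \<alpha>] geodesic_segment_unit[OF \<sigma>(1)]
      geodesic_segment_unit[OF \<rho>(1)] \<sigma> \<rho>
    by (simp add: geodesic_triangle_def)
  obtain x' y' z' where cmp: "comparison_triangle (\<alpha> 0) (\<alpha> 1) (\<beta> 1) x' y' z'"
    using comparison_triangle_exists[OF M] by blast
  then have len: "dist x' y' = d (\<alpha> 0) (\<alpha> 1)" "dist y' z' = d (\<alpha> 1) (\<beta> 1)"
    "dist z' x' = d (\<rho> 0) (\<rho> 1)"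
    using \<rho> by (simp_all add: comparison_triangle_def)
  define p' q' where "p' = (1 - t) *\<^sub>R x' + t *\<^sub>R y'" and "q' = t *\<^sub>R z' + (1 - t) *\<^sub>R x'"
  have p: "side_comparison_point (\<alpha> 0) ?A x' y' (\<alpha> t) p'"
    unfolding p'_def using side_comparison_point_geodesic[OF \<alpha> t len(1)] .
  have q: "side_comparison_point (\<beta> 1) ?C z' x' (\<beta> t) q'"
    using side_comparison_point_geodesic[OF \<rho>(1) _ len(3), of "1 - t"] t \<rho>
    by (simp add: q'_def)
  have "\<alpha> t \<in> ?A" "\<beta> t \<in> ?C"
    using p q by (simp_all add: side_comparison_point_def)
  then have "d (\<alpha> t) (\<beta> t) \<le> dist p' q'"
    using p q by (intro CAT0_inequality[OF tri cmp]) (simp_all add: comparison_point_def)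
  also have "p' - q' = t *\<^sub>R (y' - z')"
    by (simp add: p'_def q'_def algebra_simps)
  then have "dist p' q' = t * d (\<alpha> 1) (\<beta> 1)"
    using t len(2) by (simp add: dist_norm)
  finally show ?thesis .
qed

lemma dist_geodesics_common_end:
  assumes "geodesic 0 1 \<alpha>" "geodesic 0 1 \<beta>" "\<alpha> 1 = \<beta> 1" "t \<in> {0..1}"
  shows "d (\<alpha> t) (\<beta> t) \<le> (1 - t) * d (\<alpha> 0) (\<beta> 0)"
  using dist_geodesics_common_start[OF geodesic_reverse geodesic_reverse,
      OF assms(1,2), of "1 - t"] assms(3,4)
  by simp

end

theorem proposition3p4p2:
  fixes M :: "'a set" and d :: "'a \<Rightarrow> 'a \<Rightarrow> real"
    and \<gamma>\<^sub>1 \<gamma>\<^sub>2 :: "real \<Rightarrow> 'a" and t :: real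
  assumes "CAT0_space M d"
    and "Metric_space.geodesic M d 0 1 \<gamma>\<^sub>1"
    and "Metric_space.geodesic M d 0 1 \<gamma>\<^sub>2"
    and "t \<in> {0..1}"
  shows "d (\<gamma>\<^sub>1 t) (\<gamma>\<^sub>2 t) \<le> (1 - t) * d (\<gamma>\<^sub>1 0) (\<gamma>\<^sub>2 0) + t * d (\<gamma>\<^sub>1 1) (\<gamma>\<^sub>2 1)"
proof -
  interpret CAT0_space M d by fact
  have "\<gamma>\<^sub>1 0 \<in> M" "\<gamma>\<^sub>2 1 \<in> M"
    using geodesic_in_space assms(2,3) by auto
  then obtain \<delta> where \<delta>: "geodesic 0 1 \<delta>" "\<delta> 0 = \<gamma>\<^sub>1 0" "\<delta> 1 = \<gamma>\<^sub>2 1"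
    using geodesic_unit_param_exists[OF geodesic_space] by blast
  have "d (\<gamma>\<^sub>1 t) (\<gamma>\<^sub>2 t) \<le> d (\<gamma>\<^sub>1 t) (\<delta> t) + d (\<delta> t) (\<gamma>\<^sub>2 t)"
    using triangle geodesic_in_space assms(2-4) \<delta>(1) by blast
  moreover have "d (\<gamma>\<^sub>1 t) (\<delta> t) \<le> t * d (\<gamma>\<^sub>1 1) (\<gamma>\<^sub>2 1)"
    using dist_geodesics_common_start[OF assms(2) \<delta>(1) _ assms(4)] \<delta> by simp
  moreover have "d (\<delta> t) (\<gamma>\<^sub>2 t) \<le> (1 - t) * d (\<gamma>\<^sub>1 0) (\<gamma>\<^sub>2 0)"
    using dist_geodesics_common_end[OF \<delta>(1) assms(3) _ assms(4)] \<delta> by simp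
  ultimately show ?thesis by linarith
qed

end
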